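(* Suppose that $\mathcal{H}_{\mathrm u}$ is finite-dimensional and that the complexification of the linear operator $D$ on $\mathcal{H}_{\mathrm u}$ is diagonalisable. After complexification, write $$D=\sum_{j=1}^{m}\lambda_jP_j,$$ where $P_j$ are the spectral projections (and $\lambda_1,\dots,\lambda_m\in\mathbb{C}$ the distinct eigenvalues of $D$). Then the kernel $K(t):=BS_D(t)C$ satisfies $$K(t)=\sum_{j=1}^{m}e^{\lambda_jt}BP_jC,\qquad t\ge0 .$$ In particular, if all hidden modes decay exponentially ($\operatorname{Re}\lambda_j<0$ for all $j$), then $K$ is a finite sum of decaying exponential terms.
   Context: $\mathcal{H}_{\mathrm r}$ and $\mathcal{H}_{\mathrm u}$ are separable real Hilbert spaces; when complex spectra are used, one passes to the canonical complexifications of the spaces and operators without changing notation. $B:\mathcal{H}_{\mathrm u}\to\mathcal{H}_{\mathrm r}$ and $C:\mathcal{H}_{\mathrm r}\to\mathcal{H}_{\mathrm u}$ are bounded linear operators, and $S_D(t)=e^{tD}$ is the semigroup generated by $D$. *)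

theory Defs
  imports "HOL-Analysis.Analysis"
begin

section \<open>Complexification\<close>

text \<open>The pair \<open>(x, y)\<close> stands for \<open>x + i y\<close>.  The product norm
  \<open>sqrt (\<parallel>x\<parallel>\<^sup>2 + \<parallel>y\<parallel>\<^sup>2)\<close> is then the norm of the canonical complexified Hilbert space.\<close>

type_synonym 'a complexification = "'a \<times> 'a"

definition cscale :: "complex \<Rightarrow> 'a::real_vector complexification \<Rightarrow> 'a complexification"
  where "cscale z v =
    (Re z *\<^sub>R fst v - Im z *\<^sub>R snd v, Re z *\<^sub>R snd v + Im z *\<^sub>R fst v)"

global_interpretation cpx: vector_space "cscale :: complex \<Rightarrow> 'a::real_vector complexification \<Rightarrow> _"
  by unfold_locales (auto simp: cscale_def algebra_simps)

definition complexify :: "('a \<Rightarrow> 'b) \<Rightarrow> 'a complexification \<Rightarrow> 'b complexification"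
  where "complexify f = map_prod f f"

definition clinear ::
    "('a::real_vector complexification \<Rightarrow> 'b::real_vector complexification) \<Rightarrow> bool"
  where "clinear A \<longleftrightarrow> Vector_Spaces.linear cscale cscale A"

definition bounded_clinear ::
    "('a::real_normed_vector complexification \<Rightarrow> 'b::real_normed_vector complexification) \<Rightarrow> bool"
  where "bounded_clinear A \<longleftrightarrow> clinear A \<and> bounded_linear A"


section \<open>Spectral notions in finite dimension\<close>

definition eigenvalues :: "('a::real_vector complexification \<Rightarrow> 'a complexification) \<Rightarrow> complex set"
  where "eigenvalues T = {\<mu>. \<exists>v. v \<noteq> 0 \<and> T v = cscale \<mu> v}"

definition diagonalisable :: "('a::real_vector complexification \<Rightarrow> 'a complexification) \<Rightarrow> bool"
  where "diagonalisable T \<longleftrightarrow>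
    (\<exists>E. cpx.independent E \<and> cpx.span E = UNIV \<and> (\<forall>v\<in>E. \<exists>\<mu>. T v = cscale \<mu> v))"

definition gen_eigenspace ::
    "('a::real_vector complexification \<Rightarrow> 'a complexification) \<Rightarrow> complex \<Rightarrow> 'a complexification set"
  where "gen_eigenspace T \<mu> = {v. \<exists>k. ((\<lambda>w. T w - cscale \<mu> w) ^^ k) v = 0}"

text \<open>The spectral projection of \<open>T\<close> at \<open>\<mu>\<close> projects onto the generalised eigenspace at \<open>\<mu>\<close>
  along the sum of the generalised eigenspaces at the other eigenvalues.  An idempotent linear map
  is determined by its range and its kernel.\<close>

definition is_spectral_projection ::
    "('a::real_vector complexification \<Rightarrow> 'a complexification) \<Rightarrow> complex
      \<Rightarrow> ('a complexification \<Rightarrow> 'a complexification) \<Rightarrow> bool"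
  where "is_spectral_projection T \<mu> P \<longleftrightarrow>
    clinear P \<and> P \<circ> P = P \<and>
    range P = gen_eigenspace T \<mu> \<and>
    {v. P v = 0} = cpx.span (\<Union>\<nu>\<in>eigenvalues T - {\<mu>}. gen_eigenspace T \<nu>)"

definition spectral_projection ::
    "('a::real_vector complexification \<Rightarrow> 'a complexification) \<Rightarrow> complex
      \<Rightarrow> 'a complexification \<Rightarrow> 'a complexification"
  where "spectral_projection T \<mu> = (THE P. is_spectral_projection T \<mu> P)"


section \<open>Semigroup and kernel\<close>

text \<open>The exponential series is summed pointwise; for a bounded \<open>D\<close> on a Banach space (in
  particular for every linear \<open>D\<close> in finite dimension) this is the sum in operator norm.\<close>

definition exp_semigroup :: "('a \<Rightarrow> 'a::real_normed_vector) \<Rightarrow> real \<Rightarrow> 'a \<Rightarrow> 'a"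
  where "exp_semigroup D t x = (\<Sum>n. (t ^ n / fact n) *\<^sub>R (D ^^ n) x)"

definition memory_kernel ::
    "('u \<Rightarrow> 'r) \<Rightarrow> ('u \<Rightarrow> 'u::real_normed_vector) \<Rightarrow> ('r \<Rightarrow> 'u) \<Rightarrow> real \<Rightarrow> 'r \<Rightarrow> 'r"
  where "memory_kernel B D C t = B \<circ> exp_semigroup D t \<circ> C"

definition decaying_exponential_term ::
    "(real \<Rightarrow> 'a::real_normed_vector complexification \<Rightarrow> 'b::real_normed_vector complexification) \<Rightarrow> bool"
  where "decaying_exponential_term E \<longleftrightarrow>
    (\<exists>\<mu> A. Re \<mu> < 0 \<and> bounded_clinear A \<and> (\<forall>t v. E t v = cscale (exp (\<mu> * of_real t)) (A v))) \<and>
    (\<exists>\<alpha>>0. \<exists>M. \<forall>t\<ge>0. onorm (E t) \<le> M * exp (- \<alpha> * t))"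

end

theory Submission
  imports Defs
begin

text \<open>An eigenbasis of the diagonalisable operator gives, for each eigenvalue \<open>\<mu>\<close>, the projection
  \<open>Q \<mu>\<close> that keeps the basis vectors with eigenvalue \<open>\<mu>\<close> and kills the others.  These projections
  are mutually orthogonal idempotents with sum the identity, and \<open>Q \<nu> (T - \<mu>)\<^sup>k = (\<nu> - \<mu>)\<^sup>k Q \<nu>\<close>;
  hence the generalised eigenspace at \<open>\<mu>\<close> is the range of \<open>Q \<mu>\<close>, and \<open>Q \<mu>\<close> is the spectral
  projection.  Since \<open>T\<^sup>n = (\<Sum>\<mu>. \<mu>\<^sup>n Q \<mu>)\<close>, the exponential series of \<open>T\<close> sums to
  \<open>\<Sum>\<mu>. exp (\<mu> t) Q \<mu>\<close>.\<close>

section \<open>Complexified linear algebra\<close>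

text \<open>The pair type carries only a real vector space structure as a type class. This
  interpretation supplies, over the complex scalars \<open>cscale\<close>, linear extension from an
  independent set and equality of linear maps on a span.\<close>

global_interpretation cpx_pair: vector_space_pair
  "cscale :: complex \<Rightarrow> 'a::real_vector complexification \<Rightarrow> _"
  "cscale :: complex \<Rightarrow> 'b::real_vector complexification \<Rightarrow> _"
  by unfold_locales

lemma clinear_iff:
  "clinear A \<longleftrightarrow> (\<forall>v w. A (v + w) = A v + A w) \<and> (\<forall>z v. A (cscale z v) = cscale z (A v))"
  unfolding clinear_def linear_iff_module_hom
  by (auto simp: module_hom_iff cpx.module_axioms simp del: split_paired_All)

lemma clinearD:
  assumes "clinear A"
  shows clinear_add: "A (v + w) = A v + A w"
    and clinear_cscale: "A (cscale z v) = cscale z (A v)"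
    and clinear_diff: "A (v - w) = A v - A w"
    and clinear_zero: "A 0 = 0"
    and clinear_sum: "A (\<Sum>i\<in>I. g i) = (\<Sum>i\<in>I. A (g i))"
  using assms unfolding clinear_def
  by (simp_all add: cpx_pair.linear_add cpx_pair.linear_scale cpx_pair.linear_diff
      cpx_pair.linear_0 cpx_pair.linear_sum)

lemma clinear_compose: "clinear A \<Longrightarrow> clinear A' \<Longrightarrow> clinear (\<lambda>v. A' (A v))"
  by (simp add: clinear_iff del: split_paired_All)

text \<open>Reduces each identity between the projections and \<open>T\<close> to a check on
  eigenvectors.\<close>

lemma clinear_eq_on_basis:
  assumes "clinear A" "clinear A'" "cpx.span E = UNIV" "\<And>e. e \<in> E \<Longrightarrow> A e = A' e"
  shows "A v = A' v"
  using assms cpx_pair.linear_eq_on_span[of A A' E v] by (auto simp: clinear_def)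

lemma cscale_of_real: "cscale (of_real r) v = r *\<^sub>R v"
  by (simp add: cscale_def prod_eq_iff)

lemma clinear_imp_linear: "clinear A \<Longrightarrow> linear A"
  by (intro linearI) (simp_all add: clinearD flip: cscale_of_real)

lemma clinear_complexify: "linear f \<Longrightarrow> clinear (complexify f)"
  by (auto simp: clinear_iff complexify_def cscale_def linear_add linear_diff linear_cmul)

text \<open>In the expanded square, the mixed inner products of the real and imaginary components
  cancel.\<close>

lemma norm_cscale:
  fixes v :: "'a::real_inner complexification"
  shows "norm (cscale z v) = cmod z * norm v"
proof -
  have "(norm (cscale z v))\<^sup>2 = (cmod z * norm v)\<^sup>2"
    unfolding power_mult_distrib cmod_power2 power2_norm_eq_inner
    by (simp add: cscale_def inner_prod_def inner_simps inner_commute algebra_simps power2_eq_square)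
  then show ?thesis by (simp add: power2_eq_iff_nonneg)
qed

lemma bounded_linear_cscale_left:
  fixes v :: "'a::real_inner complexification"
  shows "bounded_linear (\<lambda>z. cscale z v)"
proof (rule bounded_linear_intro[where K = "norm v"])
  show "cscale (r *\<^sub>R z) v = r *\<^sub>R cscale z v" for r z
    by (simp add: cscale_def algebra_simps)
qed (simp_all add: cpx.scale_left_distrib norm_cscale)

lemma onorm_cscale_le:
  fixes A :: "'a::real_normed_vector complexification \<Rightarrow> 'b::real_inner complexification"
  assumes "bounded_linear A"
  shows "onorm (\<lambda>v. cscale z (A v)) \<le> cmod z * onorm A"
proof (rule onorm_bound)
  show "0 \<le> cmod z * onorm A" by (simp add: onorm_pos_le assms)
  show "norm (cscale z (A v)) \<le> cmod z * onorm A * norm v" for v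
    using onorm[OF assms, of v] by (simp add: norm_cscale mult.assoc mult_left_mono)
qed


section \<open>Spectral projections of a diagonalisable operator\<close>

text \<open>The vector v - P v lies in the common kernel, so Q v = Q (P v). As P v lies in the
  common range, Q fixes it. This makes the \<open>THE\<close> in \<open>spectral_projection\<close>
  well defined.\<close>

lemma is_spectral_projection_unique:
  assumes "is_spectral_projection T \<mu> P" and "is_spectral_projection T \<mu> Q"
  shows "P = Q"
proof
  fix v
  have P: "clinear P" "P (P v) = P v" and Q: "clinear Q" "\<And>w. Q (Q w) = Q w"
    and rng: "range P = range Q" and ker: "{v. P v = 0} = {v. Q v = 0}"
    using assms by (simp_all add: is_spectral_projection_def fun_eq_iff del: split_paired_All)
  have "P (v - P v) = 0" using P by (simp add: clinearD)
  then have "Q (v - P v) = 0" using ker by blast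
  moreover have "Q (P v) = P v" using rng Q(2) by (metis rangeE rangeI)
  ultimately show "P v = Q v" using Q(1) by (simp add: clinearD)
qed

lemma spectral_projection_eqI:
  "is_spectral_projection T \<mu> P \<Longrightarrow> spectral_projection T \<mu> = P"
  unfolding spectral_projection_def by (blast intro: the_equality is_spectral_projection_unique)

text \<open>Records what an eigenbasis provides without mentioning the basis. The index ranges over
  all complex numbers: off the spectrum, \<open>T_Q\<close> forces \<open>Q \<mu>\<close> to vanish,
  since a nonzero value would be an eigenvector.\<close>

locale spectral_resolution =
  fixes T :: "'a::real_vector complexification \<Rightarrow> 'a complexification"
    and Q :: "complex \<Rightarrow> 'a complexification \<Rightarrow> 'a complexification"
  assumes clinear_T: "clinear T"
    and finite_eigenvalues: "finite (eigenvalues T)"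
    and clinear_Q: "clinear (Q \<mu>)"
    and Q_Q: "Q \<mu> (Q \<nu> v) = (if \<mu> = \<nu> then Q \<nu> v else 0)"
    and T_Q: "T (Q \<mu> v) = cscale \<mu> (Q \<mu> v)"
    and Q_T: "Q \<mu> (T v) = cscale \<mu> (Q \<mu> v)"
    and sum_Q: "(\<Sum>\<mu>\<in>eigenvalues T. Q \<mu> v) = v"
begin

lemma Q_shift_power:
  "Q \<nu> (((\<lambda>w. T w - cscale \<mu> w) ^^ k) v) = cscale ((\<nu> - \<mu>) ^ k) (Q \<nu> v)"
  by (induction k)
    (simp_all add: clinearD[OF clinear_Q] Q_T cpx.scale_left_diff_distrib algebra_simps)

lemma T_power: "(T ^^ n) v = (\<Sum>\<mu>\<in>eigenvalues T. cscale (\<mu> ^ n) (Q \<mu> v))"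
  by (induction n) (simp_all add: sum_Q clinearD[OF clinear_T] T_Q mult.commute)

lemma gen_eigenspace_eq_range:
  assumes "\<mu> \<in> eigenvalues T"
  shows "gen_eigenspace T \<mu> = range (Q \<mu>)"
proof
  show "range (Q \<mu>) \<subseteq> gen_eigenspace T \<mu>"
    \<comment> \<open>Vectors in the range of \<open>Q \<mu>\<close> are genuine eigenvectors or
      zero, so the exponent 1 suffices.\<close>
    unfolding gen_eigenspace_def by (auto simp: T_Q intro!: exI[of _ 1])
  show "gen_eigenspace T \<mu> \<subseteq> range (Q \<mu>)"
  proof
    fix v assume "v \<in> gen_eigenspace T \<mu>"
    then obtain k where k: "((\<lambda>w. T w - cscale \<mu> w) ^^ k) v = 0"
      by (auto simp: gen_eigenspace_def)
    \<comment> \<open>Here (\<nu> - \<mu>)^k is a nonzero scalar whose product with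
      \<open>Q \<nu> v\<close> is zero.\<close>
    have "Q \<nu> v = 0" if "\<nu> \<noteq> \<mu>" for \<nu>
      using Q_shift_power[where k = k and \<mu> = \<mu> and \<nu> = \<nu> and v = v] that
      by (simp add: k clinearD[OF clinear_Q])
    then have "(\<Sum>\<nu>\<in>eigenvalues T. Q \<nu> v) = (\<Sum>\<nu>\<in>eigenvalues T. if \<nu> = \<mu> then Q \<mu> v else 0)"
      by (intro sum.cong refl) auto
    then have "v = (\<Sum>\<nu>\<in>eigenvalues T. if \<nu> = \<mu> then Q \<mu> v else 0)"
      unfolding sum_Q .
    also have "\<dots> = Q \<mu> v" using assms finite_eigenvalues by simp
    finally show "v \<in> range (Q \<mu>)" by (metis rangeI)
  qed
qed

text \<open>If the component at \<mu> vanishes, \<open>sum_Q\<close> writes v through the remaining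
  components. Conversely, \<open>Q \<mu>\<close> kills every other range by orthogonality.\<close>

lemma kernel_Q:
  assumes "\<mu> \<in> eigenvalues T"
  shows "{v. Q \<mu> v = 0} = cpx.span (\<Union>\<nu>\<in>eigenvalues T - {\<mu>}. range (Q \<nu>))"
proof
  show "cpx.span (\<Union>\<nu>\<in>eigenvalues T - {\<mu>}. range (Q \<nu>)) \<subseteq> {v. Q \<mu> v = 0}"
    by (rule cpx.span_minimal) (auto simp: Q_Q cpx.subspace_def clinearD[OF clinear_Q])
  show "{v. Q \<mu> v = 0} \<subseteq> cpx.span (\<Union>\<nu>\<in>eigenvalues T - {\<mu>}. range (Q \<nu>))"
  proof
    fix v assume "v \<in> {v. Q \<mu> v = 0}"
    then have "v = (\<Sum>\<nu>\<in>eigenvalues T - {\<mu>}. Q \<nu> v)"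
      using sum_Q[of v] assms finite_eigenvalues by (simp add: sum_diff1)
    also have "\<dots> \<in> cpx.span (\<Union>\<nu>\<in>eigenvalues T - {\<mu>}. range (Q \<nu>))"
      by (intro cpx.span_sum cpx.span_base) blast
    finally show "v \<in> cpx.span (\<Union>\<nu>\<in>eigenvalues T - {\<mu>}. range (Q \<nu>))" .
  qed
qed

lemma is_spectral_projection_Q:
  assumes "\<mu> \<in> eigenvalues T"
  shows "is_spectral_projection T \<mu> (Q \<mu>)"
  unfolding is_spectral_projection_def
  using assms by (auto simp: clinear_Q Q_Q fun_eq_iff gen_eigenspace_eq_range kernel_Q)

end

lemma spectral_resolution_exists:
  assumes "clinear T" "finite (eigenvalues T)" "diagonalisable T"
  obtains Q where "spectral_resolution T Q"
proof -
  obtain E \<mu> where E: "cpx.independent E" "cpx.span E = UNIV"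
    and \<mu>: "\<And>e. e \<in> E \<Longrightarrow> T e = cscale (\<mu> e) e"
    using assms(3) unfolding diagonalisable_def by metis
  \<comment> \<open>Prescribe the values on the independent set \<open>E\<close> and extend
    linearly.\<close>
  have "\<exists>Q. clinear Q \<and> (\<forall>e\<in>E. Q e = (if \<mu> e = \<nu> then e else 0))" for \<nu>
    using cpx_pair.linear_independent_extend[OF E(1), of "\<lambda>e. if \<mu> e = \<nu> then e else 0"]
    unfolding clinear_def .
  then obtain Q where Q: "\<And>\<nu>. clinear (Q \<nu>)"
    and Q_E: "\<And>\<nu> e. e \<in> E \<Longrightarrow> Q \<nu> e = (if \<mu> e = \<nu> then e else 0)"
    by metis
  \<comment> \<open>Basis vectors are nonzero, so each one is kept by exactly one summand of the sum
    over the spectrum.\<close>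
  have ev: "\<mu> e \<in> eigenvalues T" if "e \<in> E" for e
  proof -
    have "e \<noteq> 0" using that E(1) cpx.dependent_zero by metis
    then show ?thesis using \<mu>[OF that] unfolding eigenvalues_def by blast
  qed
  have cscale: "clinear (cscale z)" for z :: complex
    by (simp add: clinear_iff cpx.scale_right_distrib mult.commute del: split_paired_All)
  show ?thesis
  proof (rule that, unfold_locales)
    show "Q \<mu> (Q \<nu> v) = (if \<mu> = \<nu> then Q \<nu> v else 0)" for \<mu> \<nu> v
    proof (rule clinear_eq_on_basis[OF clinear_compose[OF Q Q] _ E(2)])
      show "clinear (\<lambda>v. if \<mu> = \<nu> then Q \<nu> v else 0)"
        by (simp add: clinear_iff clinearD[OF Q] del: split_paired_All)
    qed (auto simp: Q_E clinearD[OF Q])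
    show "T (Q \<nu> v) = cscale \<nu> (Q \<nu> v)" for \<nu> v
      by (rule clinear_eq_on_basis[OF clinear_compose[OF Q assms(1)]
            clinear_compose[OF Q cscale] E(2)])
        (auto simp: Q_E \<mu> clinearD[OF assms(1)])
    show "Q \<nu> (T v) = cscale \<nu> (Q \<nu> v)" for \<nu> v
      by (rule clinear_eq_on_basis[OF clinear_compose[OF assms(1) Q]
            clinear_compose[OF Q cscale] E(2)])
        (auto simp: Q_E \<mu> clinearD[OF Q])
    show "(\<Sum>\<nu>\<in>eigenvalues T. Q \<nu> v) = v" for v
    proof (rule clinear_eq_on_basis[OF _ _ E(2)])
      show "clinear (\<lambda>v. \<Sum>\<nu>\<in>eigenvalues T. Q \<nu> v)"
        by (simp add: clinear_iff clinearD[OF Q] sum.distrib cpx.scale_sum_right del: split_paired_All)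
      show "clinear (\<lambda>v :: 'a complexification. v)" by (simp add: clinear_iff)
      show "(\<Sum>\<nu>\<in>eigenvalues T. Q \<nu> e) = e" if "e \<in> E" for e
        using that ev assms(2) by (simp add: Q_E)
    qed
  qed (use assms Q in auto)
qed


section \<open>The exponential series\<close>

lemma complexify_funpow: "complexify f ^^ n = complexify (f ^^ n)" for f :: "'a \<Rightarrow> 'a"
  by (induction n) (auto simp: complexify_def fun_eq_iff)

lemma complexify_comp: "complexify (f \<circ> g) = complexify f \<circ> complexify g"
  by (auto simp: complexify_def)

text \<open>The scalar exponential series is transported by the bounded linear map sending z to
  \<open>cscale z w\<close>.\<close>

lemma cscale_exp_sums:
  fixes w :: "'a::real_inner complexification"
  shows "(\<lambda>n. (t ^ n / fact n) *\<^sub>R cscale (\<mu> ^ n) w) sums cscale (exp (\<mu> * of_real t)) w"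
proof -
  have "(\<lambda>n. cscale ((\<mu> * of_real t) ^ n /\<^sub>R fact n) w) sums cscale (exp (\<mu> * of_real t)) w"
    by (intro bounded_linear.sums[OF bounded_linear_cscale_left] exp_converges)
  moreover have "cscale ((\<mu> * of_real t) ^ n /\<^sub>R fact n) w = (t ^ n / fact n) *\<^sub>R cscale (\<mu> ^ n) w" for n
    by (simp add: scaleR_conv_of_real power_mult_distrib divide_inverse mult_ac flip: cscale_of_real)
  ultimately show ?thesis by simp
qed

text \<open>\<open>exp_semigroup\<close> sums a series in the real space, so convergence is
  established for the complexified series and then projected to the real and imaginary
  components.\<close>

lemma complexify_exp_semigroup:
  fixes D :: "'a::real_inner \<Rightarrow> 'a"
  assumes "spectral_resolution (complexify D) Q"
  shows "complexify (exp_semigroup D t) v =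
    (\<Sum>\<mu>\<in>eigenvalues (complexify D). cscale (exp (\<mu> * of_real t)) (Q \<mu> v))"
    (is "_ = ?R")
proof -
  interpret spectral_resolution "complexify D" Q by fact
  have *: "(\<lambda>n. (t ^ n / fact n) *\<^sub>R (complexify D ^^ n) v) sums ?R"
    unfolding T_power scaleR_sum_right by (intro sums_sum cscale_exp_sums)
  have "(\<lambda>n. (t ^ n / fact n) *\<^sub>R (D ^^ n) (fst v)) sums fst ?R"
    using bounded_linear.sums[OF bounded_linear_fst *]
    by (simp add: complexify_funpow) (simp add: complexify_def)
  moreover have "(\<lambda>n. (t ^ n / fact n) *\<^sub>R (D ^^ n) (snd v)) sums snd ?R"
    using bounded_linear.sums[OF bounded_linear_snd *]
    by (simp add: complexify_funpow) (simp add: complexify_def)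
  ultimately show ?thesis
    by (simp add: complexify_def exp_semigroup_def prod_eq_iff sums_iff)
qed


section \<open>Boundedness and decay\<close>

text \<open>Expanding in an orthogonal spanning set writes f as a finite sum of inner product
  functionals times fixed vectors.\<close>

lemma linear_imp_bounded_linear_finite_span:
  fixes S :: "'a::real_inner set" and f :: "'a \<Rightarrow> 'b::real_normed_vector"
  assumes "finite S" "span S = UNIV" "linear f"
  shows "bounded_linear f"
proof -
  obtain C :: "'a set" where C: "finite C" "span C = UNIV" "pairwise orthogonal C"
    using basis_orthogonal[OF assms(1)] assms(2) by metis
  define g where "g v = (\<Sum>c\<in>C. (inner v c / inner c c) *\<^sub>R f c)" for v
  have g: "bounded_linear g"
    unfolding g_def divide_inverse
    by (intro bounded_linear_sum bounded_linear_scaleR_const bounded_linear_mult_const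
        bounded_linear_inner_left)
  have "f v = g v" for v
  proof (rule linear_eq_on_span[OF assms(3) bounded_linear.linear[OF g]])
    fix c assume c: "c \<in> C"
    have "g c = (\<Sum>c'\<in>C. if c' = c then f c else 0)"
      unfolding g_def
    proof (rule sum.cong)
      fix c' assume "c' \<in> C"
      \<comment> \<open>The set \<open>C\<close> may contain 0; then both sides vanish because f 0 =
        0.\<close>
      then show "(inner c c' / inner c' c') *\<^sub>R f c' = (if c' = c then f c else 0)"
        using C(3) c assms(3) by (auto simp: pairwise_def orthogonal_def linear_0)
    qed simp
    then show "f c = g c" using C(1) c by simp
  qed (simp add: C(2))
  then have "f = g" by blast
  then show ?thesis using g by simp
qed

text \<open>The spanning set lives in the real space, so f is split into its restrictions to the
  real and imaginary parts.\<close>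

lemma linear_imp_bounded_linear_complexification:
  fixes S :: "'a::real_inner set" and f :: "'a complexification \<Rightarrow> 'b::real_normed_vector"
  assumes "finite S" "span S = UNIV" "linear f"
  shows "bounded_linear f"
proof -
  have "linear (\<lambda>x. f (x, 0))" "linear (\<lambda>y. f (0, y))"
    using assms(3) by (auto intro!: linearI simp flip: linear_add linear_cmul)
  then have "bounded_linear (\<lambda>v. f (fst v, 0) + f (0, snd v))"
    using assms(1,2)
    by (intro bounded_linear_add
        bounded_linear_compose[of "\<lambda>x. f (x, 0)" fst] bounded_linear_compose[of "\<lambda>y. f (0, y)" snd]
        bounded_linear_fst bounded_linear_snd linear_imp_bounded_linear_finite_span)
  moreover have "f (fst v, 0) + f (0, snd v) = f v" for v
    by (simp flip: linear_add[OF assms(3)])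
  ultimately show ?thesis by simp
qed

lemma bounded_linear_complexify:
  assumes "bounded_linear f"
  shows "bounded_linear (complexify f)"
  unfolding complexify_def map_prod_def case_prod_unfold
  by (intro bounded_linear_Pair bounded_linear_compose[OF assms] bounded_linear_fst bounded_linear_snd)

lemma decaying_exponential_termI:
  fixes A :: "'a::real_normed_vector complexification \<Rightarrow> 'b::real_inner complexification"
  assumes "Re \<mu> < 0" "bounded_clinear A"
  shows "decaying_exponential_term (\<lambda>t v. cscale (exp (\<mu> * of_real t)) (A v))"
proof -
  \<comment> \<open>The modulus of exp(\<mu> t) is exp(t Re \<mu>), which gives the rate - Re \<mu>
    and the constant \<open>onorm A\<close>.\<close>
  have "onorm (\<lambda>v. cscale (exp (\<mu> * of_real t)) (A v)) \<le> onorm A * exp (- (- Re \<mu>) * t)" for t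
    using onorm_cscale_le[of A "exp (\<mu> * of_real t)"] assms(2)
    by (simp add: bounded_clinear_def mult.commute)
  moreover have "0 < - Re \<mu>" using assms(1) by simp
  ultimately show ?thesis
    unfolding decaying_exponential_term_def using assms by blast
qed


theorem proposition3p3:
  fixes B :: "'u::{real_inner, banach} \<Rightarrow> 'r::{real_inner, banach}"
    and C :: "'r \<Rightarrow> 'u"
    and D :: "'u \<Rightarrow> 'u"
    and m :: nat
    and lam :: "nat \<Rightarrow> complex"
    and P :: "nat \<Rightarrow> 'u complexification \<Rightarrow> 'u complexification"
  assumes "separable_space (euclidean :: 'r topology)"
    and "separable_space (euclidean :: 'u topology)"
    and "\<exists>S :: 'u set. finite S \<and> span S = UNIV"
    and "bounded_linear B"
    and "bounded_linear C"
    and "linear D"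
    and "diagonalisable (complexify D)"
    and "bij_betw lam {1..m} (eigenvalues (complexify D))"
    and "\<And>j. P j = spectral_projection (complexify D) (lam j)"
  shows "(\<forall>j\<in>{1..m}. is_spectral_projection (complexify D) (lam j) (P j)) \<and>
    complexify D = (\<lambda>v. \<Sum>j=1..m. cscale (lam j) (P j v)) \<and>
    (\<forall>t\<ge>0. complexify (memory_kernel B D C t) =
      (\<lambda>v. \<Sum>j=1..m. cscale (exp (lam j * of_real t)) (complexify B (P j (complexify C v))))) \<and>
    ((\<forall>j\<in>{1..m}. Re (lam j) < 0) \<longrightarrow>
      (\<forall>j\<in>{1..m}. decaying_exponential_term
        (\<lambda>t v. cscale (exp (lam j * of_real t)) (complexify B (P j (complexify C v))))))"
proof -
  have Dl: "clinear (complexify D)" using assms(6) by (rule clinear_complexify)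
  have fin: "finite (eigenvalues (complexify D))"
    using assms(8) by (metis bij_betw_finite finite_atLeastAtMost)
  obtain Q where "spectral_resolution (complexify D) Q"
    using spectral_resolution_exists[OF Dl fin assms(7)] .
  then interpret spectral_resolution "complexify D" Q .
  have lam: "lam j \<in> eigenvalues (complexify D)" if "j \<in> {1..m}" for j
    using bij_betwE[OF assms(8)] that by blast
  have P: "P j = Q (lam j)" if "j \<in> {1..m}" for j
    unfolding assms(9) by (intro spectral_projection_eqI is_spectral_projection_Q lam that)
  \<comment> \<open>\<open>F\<close> sees both the eigenvalue and the component, so one reindexing
    serves the sum for D and the sum for the kernel.\<close>
  have reindex: "(\<Sum>\<mu>\<in>eigenvalues (complexify D). F \<mu> (Q \<mu> v)) = (\<Sum>j=1..m. F (lam j) (P j v))"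
    for F :: "complex \<Rightarrow> 'u complexification \<Rightarrow> 'b::comm_monoid_add" and v
    using sum.reindex_bij_betw[OF assms(8), of "\<lambda>\<mu>. F \<mu> (Q \<mu> v)"] by (simp add: P)
  note B = clinearD[OF clinear_complexify[OF bounded_linear.linear[OF assms(4)]]]
  show ?thesis
  proof (intro conjI ballI allI impI)
    fix j assume "j \<in> {1..m}"
    then show "is_spectral_projection (complexify D) (lam j) (P j)"
      by (simp add: P lam is_spectral_projection_Q)
  next
    show "complexify D = (\<lambda>v. \<Sum>j=1..m. cscale (lam j) (P j v))"
      using T_power[of 1] by (simp add: fun_eq_iff reindex)
  next
    fix t :: real
    show "complexify (memory_kernel B D C t) =
      (\<lambda>v. \<Sum>j=1..m. cscale (exp (lam j * of_real t)) (complexify B (P j (complexify C v))))"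
      by (rule ext)
        (simp add: memory_kernel_def complexify_comp B complexify_exp_semigroup[OF spectral_resolution_axioms]
          reindex[of "\<lambda>\<mu> w. cscale (exp (\<mu> * of_real t)) (complexify B w)"])
  next
    fix j assume neg: "\<forall>j\<in>{1..m}. Re (lam j) < 0" and j: "j \<in> {1..m}"
    obtain S :: "'u set" where S: "finite S" "span S = UNIV" using assms(3) by blast
    have Pc: "clinear (P j)" using j by (simp add: P clinear_Q)
    \<comment> \<open>Finite dimension of the hidden space enters here; \<open>B\<close> and
      \<open>C\<close> are bounded by hypothesis, as the space \<open>'r\<close> may be
      infinite-dimensional.\<close>
    have Pb: "bounded_linear (P j)"
      by (rule linear_imp_bounded_linear_complexification[OF S clinear_imp_linear[OF Pc]])
    have "clinear (\<lambda>v. complexify B (P j (complexify C v)))"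
      using assms(4,5)
      by (intro clinear_compose[OF clinear_compose[OF _ Pc]] clinear_complexify bounded_linear.linear)
    moreover have "bounded_linear (\<lambda>v. complexify B (P j (complexify C v)))"
      using assms(4,5)
      by (intro bounded_linear_compose[OF bounded_linear_complexify bounded_linear_compose[OF Pb]]
          bounded_linear_complexify)
    ultimately have "bounded_clinear (\<lambda>v. complexify B (P j (complexify C v)))"
      by (simp add: bounded_clinear_def)
    then show "decaying_exponential_term
        (\<lambda>t v. cscale (exp (lam j * of_real t)) (complexify B (P j (complexify C v))))"
      using neg j by (intro decaying_exponential_termI) auto
  qed
qed

end
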